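(* The tableau calculus for non-expansive fuzzy $\mathcal{ALC}$ with TBoxes is sound. That is, if\/~$\Gamma$ is $\mathcal{T}$-satisfiable, then every tableau for~$\Gamma$ and $T \geq 1$ has a consistent marking, where $T \geq 1$ is the concept assertion associated to $\mathcal{T}$ and $\Gamma$.
   Context: Non-expansive fuzzy $\mathcal{ALC}$: concepts $C,D ::= p \mid c \mid \lnot C \mid C \ominus c \mid C \sqcap D \mid \exists R.C$ ($p$ atomic, $R$ a role name, $c$ a rational constant in $[0,1]$). Interpretations $\mathcal{I}$: nonempty $\Delta^\mathcal{I}$, $p^\mathcal{I}:\Delta^\mathcal{I}\to[0,1]$, $R^\mathcal{I}:\Delta^\mathcal{I}\times\Delta^\mathcal{I}\to[0,1]$; $c^\mathcal{I}(x)=c$, $(\lnot D)^\mathcal{I}(x)=1-D^\mathcal{I}(x)$, $(C\ominus c)^\mathcal{I}(x)=\max(C^\mathcal{I}(x)-c,0)$, $(C\sqcap D)^\mathcal{I}(x)=\min$, $(\exists R.C)^\mathcal{I}(x)=\sup_y\min(R^\mathcal{I}(x,y),C^\mathcal{I}(y))$; $C\sqcup D=\lnot(\lnot C\sqcap\lnot D)$, $C\oplus c=\lnot((\lnot C)\ominus c)$. Concept assertions $C\bowtie c$, ${\bowtie}\in\{<,\le,>,\ge\}$; sequents are finite sets of them. TBox: set of GCIs $C\sqsubseteq D$, satisfied by $\mathcal{I}$ if $C^\mathcal{I}(x)\le D^\mathcal{I}(x)$ for all $x$; $\Gamma$ is $\mathcal{T}$-satisfiable if some $\mathcal{I}$ satisfying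 $\mathcal{T}$ has an individual satisfying all of $\Gamma$. Associated concept assertion of $\mathcal{T}=\{C_i\sqsubseteq D_i\}_{i=1}^n$ and $\Gamma$: $Z=[0,1]\cap$ (additive subgroup of $\mathbb{Q}$ generated by $1$ and the constants in $\Gamma,\mathcal{T}$), $\epsilon=\frac12\min(Z\setminus\{0\})$, $Z'=Z\cup\{z+\epsilon\mid z\in Z\setminus\{1\}\}$, $T=T_1\sqcap\cdots\sqcap T_n$, $T_i=\bigsqcup_{z\in Z'}((\lnot C_i\oplus z)\sqcap(D_i\oplus(1-z)))$. Tableau rules (${\triangleleft}\in\{<,\le\}$, ${\triangleright}\in\{>,\ge\}$; ${\bowtie^\circ}$ reverses direction $>\leftrightarrow<$, $\ge\leftrightarrow\le$; $\blacktriangleleft_{(\triangleleft,\triangleright)}$ is $<$ if $(\triangleleft,\triangleright)=(\le,\ge)$, else $\le$): (Ax 1) $S,p\triangleright c/\bot$ if $c\ge1$ (for $>$) resp. $c>1$ (for $\ge$); (Ax 0) $S,p\triangleleft c/\bot$ if $c\le0$ (for $<$) resp. $c<0$ (for $\le$); (Ax c) $S,c\triangleleft d/\bot$ if the constant inequality $c\triangleleft d$ is false; (Ax p) $S,p\triangleleft c,p\triangleright d/\bot$ if $d\blacktriangleleft_{(\triangleleft,\triangleright)}c$; ($\sqcap\triangleright$) $S,C\sqcap D\triangleright c/S,C\triangleright c,D\triangleright c$; ($\sqcap\triangleleft$) $S,C\sqcap D\triangleleft c/S,C\triangleleft c\mid S,D\triangleleft c$; ($\lnot\bowtie$) $S,\lnot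 C\bowtie c/S,C\bowtie^\circ1-c$; ($\ominus\triangleleft$) $S,C\ominus c\triangleleft d/S,C\triangleleft d+c,d\triangleleft^\circ0$; ($\ominus\triangleright$) $S,C\ominus c\triangleright d/S,C\triangleright d+c$ if $d\ge0$ (for $>$) resp. $d>0$ (for $\ge$); ($\exists R$) $S,\{\exists R.D_j\triangleleft_jd_j\}_{j=1}^n,\exists R.C\triangleright c/\{D_j\triangleleft_jd_j\mid d_j\blacktriangleleft_{(\triangleleft_j,\triangleright)}c\},C\triangleright c,T\ge1$ if $c\ge0$ (for $>$) resp. $c>0$ (for $\ge$) and $S$ contains no $\exists R.D\triangleleft d$. Propositional rules are all but ($\exists R$); saturated = no propositional rule applicable. Tableau graph: directed graph $(V^G,E^G)$, root $r^G$, labels $\mathcal{L}^G(v)$ (assertion set or $\bot$); AND-nodes have saturated labels, others are OR-nodes. A tableau for $\Gamma$ and $T\ge1$: root label $\Gamma\cup\{T\ge1\}$, each OR-node's children are labelled exactly by the conclusions of one propositional rule instance applied to its label, each AND-node's children exactly by the conclusions of all possible ($\exists R$) applications. A marking is a full subgraph containing the root, all children of its AND-nodes and at least one child of each of its OR-nodes; consistent if no node is labelled $\bot$.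
   Formalization: The side condition of (Ax p), for p ◁ c and p ▷ d, is taken as c ◀ d rather than d ◀ c: as printed the rule closes satisfiable sequents such as p ≤ 0.8, p ≥ 0.3, and soundness would fail. *)

theory Defs
  imports Complex_Main "HOL-Computational_Algebra.Group_Closure"
begin

section \<open>Syntax\<close>

text \<open>
  Concept constants range over all rationals, because the rule for \<open>C \<ominus> c \<triangleleft> d\<close> below turns
  an arbitrary bound \<open>d\<close> into a constant concept; the restriction of the concept language to
  constants in \<open>[0,1]\<close> is the predicate \<open>wf_concept\<close>.
\<close>

datatype ('a, 'r) concept =
    Atom 'a
  | Const rat
  | Neg "('a, 'r) concept"
  | Minus "('a, 'r) concept" rat
  | Conj "('a, 'r) concept" "('a, 'r) concept"
  | Exists 'r "('a, 'r) concept"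

fun concept_consts :: "('a, 'r) concept \<Rightarrow> rat set" where
  "concept_consts (Atom p) = {}"
| "concept_consts (Const c) = {c}"
| "concept_consts (Neg C) = concept_consts C"
| "concept_consts (Minus C c) = insert c (concept_consts C)"
| "concept_consts (Conj C D) = concept_consts C \<union> concept_consts D"
| "concept_consts (Exists R C) = concept_consts C"

definition wf_concept :: "('a, 'r) concept \<Rightarrow> bool" where
  "wf_concept C \<longleftrightarrow> concept_consts C \<subseteq> {0..1}"

definition Disj :: "('a, 'r) concept \<Rightarrow> ('a, 'r) concept \<Rightarrow> ('a, 'r) concept" where
  "Disj C D = Neg (Conj (Neg C) (Neg D))"

definition Plus :: "('a, 'r) concept \<Rightarrow> rat \<Rightarrow> ('a, 'r) concept" where
  "Plus C c = Neg (Minus (Neg C) c)"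

fun Big_Conj :: "('a, 'r) concept list \<Rightarrow> ('a, 'r) concept" where
  "Big_Conj [] = Const 1"
| "Big_Conj [C] = C"
| "Big_Conj (C # D # Cs) = Conj C (Big_Conj (D # Cs))"

fun Big_Disj :: "('a, 'r) concept list \<Rightarrow> ('a, 'r) concept" where
  "Big_Disj [] = Const 0"
| "Big_Disj [C] = C"
| "Big_Disj (C # D # Cs) = Disj C (Big_Disj (D # Cs))"

datatype cmp = Lt | Le | Gt | Ge

fun cmp_holds :: "cmp \<Rightarrow> 'x::linorder \<Rightarrow> 'x \<Rightarrow> bool" where
  "cmp_holds Lt x y \<longleftrightarrow> x < y"
| "cmp_holds Le x y \<longleftrightarrow> x \<le> y"
| "cmp_holds Gt x y \<longleftrightarrow> x > y"
| "cmp_holds Ge x y \<longleftrightarrow> x \<ge> y"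

fun cmp_rev :: "cmp \<Rightarrow> cmp" where
  "cmp_rev Lt = Gt"
| "cmp_rev Le = Ge"
| "cmp_rev Gt = Lt"
| "cmp_rev Ge = Le"

datatype ('a, 'r) assertion = Assert "('a, 'r) concept" cmp rat

type_synonym ('a, 'r) sequent = "('a, 'r) assertion set"

type_synonym ('a, 'r) gci = "('a, 'r) concept \<times> ('a, 'r) concept"

text \<open>The bounds of assertions are not restricted to \<open>[0,1]\<close>; the rules do not preserve this.\<close>

definition wf_sequent :: "('a, 'r) sequent \<Rightarrow> bool" where
  "wf_sequent \<Gamma> \<longleftrightarrow> finite \<Gamma> \<and> (\<forall>C b c. Assert C b c \<in> \<Gamma> \<longrightarrow> wf_concept C)"

definition wf_tbox :: "('a, 'r) gci set \<Rightarrow> bool" where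
  "wf_tbox \<T> \<longleftrightarrow> finite \<T> \<and> (\<forall>(C, D)\<in>\<T>. wf_concept C \<and> wf_concept D)"


section \<open>Semantics\<close>

record ('a, 'r, 'd) interp =
  carr :: "'d set"
  atom_val :: "'a \<Rightarrow> 'd \<Rightarrow> real"
  role_val :: "'r \<Rightarrow> 'd \<Rightarrow> 'd \<Rightarrow> real"

definition interpretation_ok :: "('a, 'r, 'd) interp \<Rightarrow> bool" where
  "interpretation_ok I \<longleftrightarrow> carr I \<noteq> {}
     \<and> (\<forall>p. \<forall>x\<in>carr I. atom_val I p x \<in> {0..1})
     \<and> (\<forall>R. \<forall>x\<in>carr I. \<forall>y\<in>carr I. role_val I R x y \<in> {0..1})"

fun sem :: "('a, 'r, 'd) interp \<Rightarrow> ('a, 'r) concept \<Rightarrow> 'd \<Rightarrow> real" where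
  "sem I (Atom p) x = atom_val I p x"
| "sem I (Const c) x = of_rat c"
| "sem I (Neg C) x = 1 - sem I C x"
| "sem I (Minus C c) x = max (sem I C x - of_rat c) 0"
| "sem I (Conj C D) x = min (sem I C x) (sem I D x)"
| "sem I (Exists R C) x = (SUP y\<in>carr I. min (role_val I R x y) (sem I C y))"

fun sat_assertion :: "('a, 'r, 'd) interp \<Rightarrow> 'd \<Rightarrow> ('a, 'r) assertion \<Rightarrow> bool" where
  "sat_assertion I x (Assert C b c) \<longleftrightarrow> cmp_holds b (sem I C x) (of_rat c)"

definition sat_tbox :: "('a, 'r, 'd) interp \<Rightarrow> ('a, 'r) gci set \<Rightarrow> bool" where
  "sat_tbox I \<T> \<longleftrightarrow> (\<forall>(C, D)\<in>\<T>. \<forall>x\<in>carr I. sem I C x \<le> sem I D x)"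

text \<open>The type argument fixes the type from which the individuals are drawn.\<close>

definition tbox_satisfiable ::
    "'d itself \<Rightarrow> ('a, 'r) gci set \<Rightarrow> ('a, 'r) sequent \<Rightarrow> bool" where
  "tbox_satisfiable _ \<T> \<Gamma> \<longleftrightarrow>
     (\<exists>I :: ('a, 'r, 'd) interp. interpretation_ok I \<and> sat_tbox I \<T>
        \<and> (\<exists>x\<in>carr I. \<forall>A\<in>\<Gamma>. sat_assertion I x A))"


section \<open>The concept associated to a TBox and a sequent\<close>

fun assertion_consts :: "('a, 'r) assertion \<Rightarrow> rat set" where
  "assertion_consts (Assert C b c) = insert c (concept_consts C)"

definition sequent_consts :: "('a, 'r) sequent \<Rightarrow> rat set" where
  "sequent_consts \<Gamma> = (\<Union>A\<in>\<Gamma>. assertion_consts A)"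

definition tbox_consts :: "('a, 'r) gci set \<Rightarrow> rat set" where
  "tbox_consts \<T> = (\<Union>(C, D)\<in>\<T>. concept_consts C \<union> concept_consts D)"

definition value_grid :: "('a, 'r) gci set \<Rightarrow> ('a, 'r) sequent \<Rightarrow> rat set" where
  "value_grid \<T> \<Gamma> =
     {0..1} \<inter> group_closure (insert 1 (sequent_consts \<Gamma> \<union> tbox_consts \<T>))"

definition half_step :: "('a, 'r) gci set \<Rightarrow> ('a, 'r) sequent \<Rightarrow> rat" where
  "half_step \<T> \<Gamma> = Min (value_grid \<T> \<Gamma> - {0}) / 2"

definition fine_grid :: "('a, 'r) gci set \<Rightarrow> ('a, 'r) sequent \<Rightarrow> rat set" where
  "fine_grid \<T> \<Gamma> = value_grid \<T> \<Gamma> \<union> {z + half_step \<T> \<Gamma> | z. z \<in> value_grid \<T> \<Gamma> - {1}}"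

definition gci_concept :: "rat set \<Rightarrow> ('a, 'r) gci \<Rightarrow> ('a, 'r) concept" where
  "gci_concept Z' = (\<lambda>(C, D).
     Big_Disj (map (\<lambda>z. Conj (Plus (Neg C) z) (Plus D (1 - z))) (sorted_list_of_set Z')))"

text \<open>
  The TBox is given by an enumeration \<open>C\<^sub>1 \<sqsubseteq> D\<^sub>1, \<dots>, C\<^sub>n \<sqsubseteq> D\<^sub>n\<close>, which fixes the order of the
  conjuncts.
\<close>

definition assoc_concept :: "('a, 'r) gci list \<Rightarrow> ('a, 'r) sequent \<Rightarrow> ('a, 'r) concept" where
  "assoc_concept ts \<Gamma> = Big_Conj (map (gci_concept (fine_grid (set ts) \<Gamma>)) ts)"

text \<open>\<open>Min\<close> and \<open>sorted_list_of_set\<close> are applied above to finite sets only:\<close>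

lemma finite_concept_consts: "finite (concept_consts C)"
  by (induction C) auto

lemma finite_sequent_consts:
  assumes "finite \<Gamma>"
  shows "finite (sequent_consts \<Gamma>)"
proof -
  have "finite (assertion_consts A)" for A :: "('a, 'b) assertion"
    by (cases A) (simp add: finite_concept_consts)
  then show ?thesis
    using assms by (simp add: sequent_consts_def)
qed

lemma finite_tbox_consts:
  assumes "finite \<T>"
  shows "finite (tbox_consts \<T>)"
  using assms by (auto simp: tbox_consts_def finite_concept_consts)

lemma common_denominator:
  fixes S :: "rat set"
  assumes "finite S"
  shows "\<exists>N::int. N > 0 \<and> (\<forall>s\<in>S. s * of_int N \<in> \<int>)"
  using assms
proof (induction S)
  case empty
  show ?case by (intro exI[of _ 1]) auto
next
  case (insert s S)
  then obtain N :: int where N: "N > 0" "\<forall>s\<in>S. s * of_int N \<in> \<int>" by blast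
  obtain a b :: int where ab: "s = of_int a / of_int b" "b > 0"
    by (metis quotient_of_denom_pos quotient_of_div surj_pair)
  have "s * of_int (b * N) = of_int (a * N)"
    using ab by simp
  moreover have "t * of_int (b * N) \<in> \<int>" if "t \<in> S" for t
  proof -
    have "t * of_int (b * N) = of_int b * (t * of_int N)" by simp
    then show ?thesis using N(2) that by (metis Ints_mult Ints_of_int)
  qed
  moreover have "b * N > 0" using ab N by simp
  ultimately show ?case
    by (intro exI[of _ "b * N"]) (simp del: of_int_mult)
qed

lemma finite_value_grid:
  assumes "finite \<T>" "finite \<Gamma>"
  shows "finite (value_grid \<T> \<Gamma>)"
proof -
  let ?S = "insert 1 (sequent_consts \<Gamma> \<union> tbox_consts \<T>)"
  obtain N :: int where N: "N > 0" "\<forall>s\<in>?S. s * of_int N \<in> \<int>"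
    using common_denominator[of ?S] finite_sequent_consts finite_tbox_consts assms by auto
  have int: "s * of_int N \<in> \<int>" if "s \<in> group_closure ?S" for s
    using that
  proof induction
    case (base s)
    then consider "s = 0" | "s \<in> ?S" by blast
    then show ?case using N(2) by cases auto
  next
    case (diff s t)
    then show ?case by (simp add: left_diff_distrib)
  qed
  have "value_grid \<T> \<Gamma> \<subseteq> (\<lambda>k. of_int k / of_int N) ` {0..N}"
  proof
    fix s assume s: "s \<in> value_grid \<T> \<Gamma>"
    then have "s * of_int N \<in> \<int>" and s01: "0 \<le> s" "s \<le> 1"
      using int by (auto simp: value_grid_def)
    then obtain k :: int where k: "s * of_int N = of_int k" by (auto elim: Ints_cases)
    have "0 \<le> (of_int k :: rat)" "(of_int k :: rat) \<le> of_int N"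
      unfolding k[symmetric] using s01 N(1) by (auto simp: mult_left_le_one_le)
    then have "k \<in> {0..N}" by simp
    moreover have "s = of_int k / of_int N" using k N(1) by (simp add: field_simps)
    ultimately show "s \<in> (\<lambda>k. of_int k / of_int N) ` {0..N}" by blast
  qed
  then show ?thesis by (rule finite_subset) simp
qed

lemma finite_fine_grid:
  assumes "finite \<T>" "finite \<Gamma>"
  shows "finite (fine_grid \<T> \<Gamma>)"
  using finite_value_grid[OF assms] by (simp add: fine_grid_def)


section \<open>Tableau rules\<close>

datatype ('a, 'r) label = Seq "('a, 'r) sequent" | Bot

text \<open>
  For an upper bound \<open>\<triangleleft> x\<close> and a lower bound \<open>\<triangleright> y\<close>, \<open>x \<blacktriangleleft> y\<close> says that no value satisfies both.
\<close>

definition clash :: "cmp \<Rightarrow> cmp \<Rightarrow> rat \<Rightarrow> rat \<Rightarrow> bool" where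
  "clash l g x y \<longleftrightarrow> (if (l, g) = (Le, Ge) then x < y else x \<le> y)"

text \<open>
  \<open>prop_rule S Ls\<close>: some propositional rule instance with premise \<open>S\<close> has exactly the
  conclusions \<open>Ls\<close>. Throughout, \<open>l\<close> is one of \<open><\<close>, \<open>\<le>\<close> and \<open>g\<close> is one of \<open>>\<close>, \<open>\<ge>\<close>.
  The context \<open>S\<close> of a rule may or may not contain the principal assertion.
\<close>

inductive prop_rule :: "('a, 'r) sequent \<Rightarrow> ('a, 'r) label set \<Rightarrow> bool" where
  Ax_1: "\<lbrakk>g = Gt \<and> c \<ge> 1 \<or> g = Ge \<and> c > 1\<rbrakk>
    \<Longrightarrow> prop_rule (insert (Assert (Atom p) g c) S) {Bot}"
| Ax_0: "\<lbrakk>l = Lt \<and> c \<le> 0 \<or> l = Le \<and> c < 0\<rbrakk>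
    \<Longrightarrow> prop_rule (insert (Assert (Atom p) l c) S) {Bot}"
| Ax_c: "\<lbrakk>l \<in> {Lt, Le}; \<not> cmp_holds l c d\<rbrakk>
    \<Longrightarrow> prop_rule (insert (Assert (Const c) l d) S) {Bot}"
| Ax_p: "\<lbrakk>l \<in> {Lt, Le}; g \<in> {Gt, Ge}; clash l g c d\<rbrakk>
    \<Longrightarrow> prop_rule (insert (Assert (Atom p) l c) (insert (Assert (Atom p) g d) S)) {Bot}"
| Conj_gt: "\<lbrakk>g \<in> {Gt, Ge}\<rbrakk>
    \<Longrightarrow> prop_rule (insert (Assert (Conj C D) g c) S)
          {Seq (insert (Assert C g c) (insert (Assert D g c) S))}"
| Conj_lt: "\<lbrakk>l \<in> {Lt, Le}\<rbrakk>
    \<Longrightarrow> prop_rule (insert (Assert (Conj C D) l c) S)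
          {Seq (insert (Assert C l c) S), Seq (insert (Assert D l c) S)}"
| Neg: "prop_rule (insert (Assert (Neg C) b c) S)
          {Seq (insert (Assert C (cmp_rev b) (1 - c)) S)}"
| Minus_lt: "\<lbrakk>l \<in> {Lt, Le}\<rbrakk>
    \<Longrightarrow> prop_rule (insert (Assert (Minus C c) l d) S)
          {Seq (insert (Assert C l (d + c)) (insert (Assert (Const d) (cmp_rev l) 0) S))}"
| Minus_gt: "\<lbrakk>g = Gt \<and> d \<ge> 0 \<or> g = Ge \<and> d > 0\<rbrakk>
    \<Longrightarrow> prop_rule (insert (Assert (Minus C c) g d) S)
          {Seq (insert (Assert C g (d + c)) S)}"

inductive ex_rule ::
    "('a, 'r) concept \<Rightarrow> ('a, 'r) sequent \<Rightarrow> ('a, 'r) sequent \<Rightarrow> bool" for T where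
  Ex_gt: "\<lbrakk>g = Gt \<and> c \<ge> 0 \<or> g = Ge \<and> c > 0;
        \<forall>j<n. l j \<in> {Lt, Le};
        \<forall>D b d. b \<in> {Lt, Le} \<longrightarrow> Assert (Exists R D) b d \<notin> S\<rbrakk>
    \<Longrightarrow> ex_rule T
          (S \<union> {Assert (Exists R (D j)) (l j) (d j) | j::nat. j < n} \<union> {Assert (Exists R C) g c})
          ({Assert (D j) (l j) (d j) | j::nat. j < n \<and> clash (l j) g (d j) c}
             \<union> {Assert C g c, Assert T Ge 1})"

text \<open>No rule applies to \<open>\<bottom>\<close>, so it counts as saturated.\<close>

fun saturated :: "('a, 'r) label \<Rightarrow> bool" where
  "saturated (Seq S) \<longleftrightarrow> (\<nexists>Ls. prop_rule S Ls)"
| "saturated Bot \<longleftrightarrow> True"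


section \<open>Tableaux and markings\<close>

record ('v, 'a, 'r) tgraph =
  verts :: "'v set"
  edges :: "('v \<times> 'v) set"
  root :: 'v
  label :: "'v \<Rightarrow> ('a, 'r) label"

definition tableau_graph :: "('v, 'a, 'r) tgraph \<Rightarrow> bool" where
  "tableau_graph G \<longleftrightarrow> edges G \<subseteq> verts G \<times> verts G \<and> root G \<in> verts G
     \<and> (\<forall>v\<in>verts G. \<forall>S. label G v = Seq S \<longrightarrow> finite S)"

definition children :: "('v, 'a, 'r) tgraph \<Rightarrow> 'v \<Rightarrow> 'v set" where
  "children G v = {w. (v, w) \<in> edges G}"

definition and_node :: "('v, 'a, 'r) tgraph \<Rightarrow> 'v \<Rightarrow> bool" where
  "and_node G v \<longleftrightarrow> v \<in> verts G \<and> saturated (label G v)"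

definition or_node :: "('v, 'a, 'r) tgraph \<Rightarrow> 'v \<Rightarrow> bool" where
  "or_node G v \<longleftrightarrow> v \<in> verts G \<and> \<not> saturated (label G v)"

definition tableau ::
    "('a, 'r) sequent \<Rightarrow> ('a, 'r) concept \<Rightarrow> ('v, 'a, 'r) tgraph \<Rightarrow> bool" where
  "tableau \<Gamma> T G \<longleftrightarrow> tableau_graph G
     \<and> label G (root G) = Seq (\<Gamma> \<union> {Assert T Ge 1})
     \<and> (\<forall>v. or_node G v \<longrightarrow>
          (\<exists>S Ls. label G v = Seq S \<and> prop_rule S Ls \<and> label G ` children G v = Ls))
     \<and> (\<forall>v. and_node G v \<longrightarrow>
          label G ` children G v = {Seq S' | S S'. label G v = Seq S \<and> ex_rule T S S'})"

definition full_subgraph :: "('v, 'a, 'r) tgraph \<Rightarrow> ('v, 'a, 'r) tgraph \<Rightarrow> bool" where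
  "full_subgraph M G \<longleftrightarrow> verts M \<subseteq> verts G
     \<and> edges M = edges G \<inter> (verts M \<times> verts M)
     \<and> (\<forall>v\<in>verts M. label M v = label G v)"

definition marking :: "('v, 'a, 'r) tgraph \<Rightarrow> ('v, 'a, 'r) tgraph \<Rightarrow> bool" where
  "marking G M \<longleftrightarrow> full_subgraph M G
     \<and> root M = root G \<and> root G \<in> verts M
     \<and> (\<forall>v\<in>verts M. and_node G v \<longrightarrow> children G v \<subseteq> verts M)
     \<and> (\<forall>v\<in>verts M. or_node G v \<longrightarrow> children G v \<inter> verts M \<noteq> {})"

definition consistent :: "('v, 'a, 'r) tgraph \<Rightarrow> bool" where
  "consistent M \<longleftrightarrow> (\<forall>v\<in>verts M. label M v \<noteq> Bot)"

end

theory Submission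
  imports Defs
begin

text \<open>
  A model of \<open>\<T>\<close> need not satisfy \<open>T \<ge> 1\<close>, because the values of \<open>C\<^sub>i\<close> and \<open>D\<^sub>i\<close> may lie strictly
  between two neighbouring points of \<open>Z'\<close>. The additive group generated by the constants is
  \<open>(1/N)\<int>\<close>, and rounding every real number that is not in this group to the midpoint of its
  cell of length \<open>1/N\<close> is monotone and commutes with \<open>\<not>\<close>, \<open>\<ominus> c\<close> and \<open>\<sqinter>\<close>. It commutes with
  suprema only if they are attained, so the model is first replaced by an ultrapower along a
  nonprincipal ultrafilter on the natural numbers, in which all suprema are attained. The rounded
  ultrapower still satisfies \<open>\<Gamma>\<close>, its values lie in \<open>Z'\<close> so that it satisfies \<open>T \<ge> 1\<close> everywhere, and
  it has only finitely many values so that suprema are again attained. The nodes whose labels are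
  satisfied at some individual of this model form a consistent marking.
\<close>

section \<open>Ultrafilters\<close>

definition ultrafilter :: "'a filter \<Rightarrow> bool" where
  "ultrafilter F \<longleftrightarrow> F \<noteq> bot \<and> (\<forall>P. eventually P F \<or> eventually (\<lambda>x. \<not> P x) F)"

lemma ultrafilter_nontrivial: "ultrafilter F \<Longrightarrow> F \<noteq> bot"
  by (simp add: ultrafilter_def)

text \<open>A chain is directed downwards, so whatever holds eventually along its infimum already
  holds eventually along some member; this is applied to \<open>False\<close>.\<close>

lemma Inf_chain_filter_neq_bot:
  fixes B :: "'a filter set"
  assumes "B \<noteq> {}" "bot \<notin> B" "\<And>F G. F \<in> B \<Longrightarrow> G \<in> B \<Longrightarrow> F \<le> G \<or> G \<le> F"
  shows "Inf B \<noteq> bot"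
proof
  assume "Inf B = bot"
  then have "eventually (\<lambda>_. False) (Inf B)" by simp
  moreover have "\<exists>H\<in>B. H \<le> inf F G" if "F \<in> B" "G \<in> B" for F G
    using assms(3)[OF that] that by (metis inf.absorb1 inf.absorb2 order_refl)
  ultimately obtain F where "F \<in> B" "eventually (\<lambda>_. False) F"
    using eventually_Inf_base[OF assms(1)] by blast
  then show False using assms(2) by (metis trivial_limit_def)
qed

text \<open>By Zorn's lemma there is a minimal proper filter below \<open>F\<close>, and minimality
  among proper filters decides every predicate.\<close>

lemma exists_ultrafilter_le:
  fixes F :: "'a filter"
  assumes "F \<noteq> bot"
  obtains U where "ultrafilter U" "U \<le> F"
proof -
  let ?A = "{G. G \<noteq> bot \<and> G \<le> F}"
  \<comment> \<open>The order is reversed, because Zorn's lemma yields maximal elements and the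
    finest filter is sought.\<close>
  let ?P = "\<lambda>G H :: 'a filter. H \<le> G"
  have "\<exists>U\<in>?A. \<forall>G\<in>?A. ?P U G \<longrightarrow> G = U"
  proof (rule predicate_Zorn)
    show "partial_order_on ?A (relation_of ?P ?A)"
      by (rule partial_order_on_relation_ofI) auto
  next
    fix B assume B: "B \<in> Chains (relation_of ?P ?A)"
    show "\<exists>U\<in>?A. \<forall>G\<in>B. ?P G U"
    proof (cases "B = {}")
      case True
      then show ?thesis using assms by auto
    next
      case False
      have sub: "B \<subseteq> ?A" and "\<And>G H. G \<in> B \<Longrightarrow> H \<in> B \<Longrightarrow> G \<le> H \<or> H \<le> G"
        using B by (auto simp: Chains_def relation_of_def)
      with False have "Inf B \<noteq> bot"
        by (intro Inf_chain_filter_neq_bot) auto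
      moreover have "Inf B \<le> F"
        using False sub by (metis (mono_tags, lifting) Inf_lower2 all_not_in_conv mem_Collect_eq subsetD)
      ultimately show ?thesis
        by (intro bexI[of _ "Inf B"]) (auto intro: Inf_lower)
    qed
  qed
  then obtain U where U: "U \<noteq> bot" "U \<le> F"
      and min: "\<And>G. G \<noteq> bot \<Longrightarrow> G \<le> U \<Longrightarrow> G = U"
    by (metis (mono_tags, lifting) mem_Collect_eq order_trans)
  have "eventually P U \<or> eventually (\<lambda>x. \<not> P x) U" for P
  \<comment> \<open>Restricting \<open>U\<close> to \<open>P\<close> either makes it improper, so
    that the negation of \<open>P\<close> holds eventually, or gives back \<open>U\<close> by
    minimality.\<close>
  proof (cases "inf U (principal {x. P x}) = bot")
    case True
    then have "eventually (\<lambda>_. False) (inf U (principal {x. P x}))" by simp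
    then show ?thesis by (simp add: eventually_inf_principal)
  next
    case False
    then have "U \<le> principal {x. P x}"
      using min[of "inf U (principal {x. P x})"] by (metis inf.cobounded1 inf.cobounded2)
    then show ?thesis by (simp add: le_principal)
  qed
  with U show thesis by (intro that[of U]) (auto simp: ultrafilter_def)
qed

text \<open>The limit is the supremum of the eventual lower bounds: by the ultrafilter property, a
  number \<open>a \<le> 1\<close> that is not one of them lies eventually above
  \<open>f\<close>.\<close>

lemma ultrafilter_tendsto_Lim:
  fixes f :: "'a \<Rightarrow> real"
  assumes F: "ultrafilter F" and f: "\<And>n. f n \<in> {0..1}"
  shows "(f \<longlongrightarrow> Lim F f) F"
proof -
  let ?A = "{a. a \<le> 1 \<and> (\<forall>\<^sub>F n in F. a \<le> f n)}"
  have bdd: "bdd_above ?A" by (auto intro: bdd_aboveI[of _ 1])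
  have ne: "?A \<noteq> {}" using f by (auto intro!: exI[of _ 0] always_eventually)
  have "(f \<longlongrightarrow> Sup ?A) F"
  proof (rule order_tendstoI)
    fix a assume "a < Sup ?A"
    then obtain b where "a < b" "b \<in> ?A"
      using less_cSup_iff[OF ne bdd] by blast
    then show "\<forall>\<^sub>F n in F. a < f n" by (auto elim: eventually_mono)
  next
    fix a assume a: "Sup ?A < a"
    then have "a \<notin> ?A" using cSup_upper[OF _ bdd] by (meson not_le)
    then consider "a > 1" | "\<not> (\<forall>\<^sub>F n in F. a \<le> f n)" by auto
    then show "\<forall>\<^sub>F n in F. f n < a"
    proof cases
      case 1
      have "f n < a" for n using f[of n] 1 by simp
      then show ?thesis by simp
    next
      case 2
      then show ?thesis using F by (auto simp: ultrafilter_def not_le)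
    qed
  qed
  then show ?thesis
    using tendsto_Lim[OF ultrafilter_nontrivial[OF F]] by metis
qed

lemma ultrafilter_Lim_in_unit:
  fixes f :: "'a \<Rightarrow> real"
  assumes "ultrafilter F" "\<And>n. f n \<in> {0..1}"
  shows "Lim F f \<in> {0..1}"
proof -
  note lim = ultrafilter_tendsto_Lim[of F f, OF assms]
  note nb = ultrafilter_nontrivial[OF assms(1)]
  have "0 \<le> Lim F f" using assms(2) by (intro tendsto_lowerbound[OF lim _ nb]) auto
  moreover have "Lim F f \<le> 1" using assms(2) by (intro tendsto_upperbound[OF lim _ nb]) auto
  ultimately show ?thesis by simp
qed


section \<open>Rounding\<close>

text \<open>Floor and ceiling agree on integers and differ by one elsewhere, so for
  \<open>N > 0\<close> points of (1/N)\<int> are fixed and all others go to the midpoint of their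
  cell.\<close>

definition grid_round :: "nat \<Rightarrow> real \<Rightarrow> real" where
  "grid_round N v = (of_int \<lfloor>of_nat N * v\<rfloor> + of_int \<lceil>of_nat N * v\<rceil>) / (2 * of_nat N)"

lemma grid_round_mono: "v \<le> w \<Longrightarrow> grid_round N v \<le> grid_round N w"
  unfolding grid_round_def
  by (intro divide_right_mono add_mono) (auto intro!: floor_mono ceiling_mono mult_left_mono)

lemma mono_grid_round: "mono (grid_round N)"
  by (rule monoI) (rule grid_round_mono)

lemma grid_round_min: "grid_round N (min v w) = min (grid_round N v) (grid_round N w)"
  using mono_grid_round by (rule min_of_mono[symmetric])

lemma grid_round_max: "grid_round N (max v w) = max (grid_round N v) (grid_round N w)"
  using mono_grid_round by (rule max_of_mono[symmetric])

lemma grid_round_minus: "grid_round N (- v) = - grid_round N v"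
proof -
  have "grid_round N (- v) = - (of_int \<lceil>of_nat N * v\<rceil> + of_int \<lfloor>of_nat N * v\<rfloor>) / (2 * of_nat N)"
    by (simp add: grid_round_def ceiling_minus floor_minus)
  then show ?thesis by (simp only: grid_round_def minus_divide_left add.commute)
qed

lemma grid_round_grid:
  "N > 0 \<Longrightarrow> grid_round N (of_int k / of_nat N) = of_int k / of_nat N"
  by (simp add: grid_round_def)

lemma grid_round_add_grid:
  assumes "N > 0"
  shows "grid_round N (v + of_int k / of_nat N) = grid_round N v + of_int k / of_nat N"
proof -
  have "of_nat N * (v + of_int k / of_nat N) = of_nat N * v + of_int k"
    using assms by (simp add: field_simps)
  then have "grid_round N (v + of_int k / of_nat N) =
      (of_int \<lfloor>of_nat N * v\<rfloor> + of_int \<lceil>of_nat N * v\<rceil> + 2 * of_int k) / (2 * of_nat N)"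
    unfolding grid_round_def by simp
  then show ?thesis using assms by (simp add: grid_round_def add_divide_distrib)
qed

lemma grid_round_0: "grid_round N 0 = 0"
  by (simp add: grid_round_def)

lemma grid_round_1: "N > 0 \<Longrightarrow> grid_round N 1 = 1"
  using grid_round_grid[of N "int N"] by simp

lemma grid_round_compl: "N > 0 \<Longrightarrow> grid_round N (1 - v) = 1 - grid_round N v"
  using grid_round_add_grid[of N "- v" "int N"] by (simp add: grid_round_minus)

lemma grid_round_diff_grid:
  "N > 0 \<Longrightarrow> grid_round N (v - of_int k / of_nat N) = grid_round N v - of_int k / of_nat N"
  using grid_round_add_grid[of N v "- k"] by simp

lemma grid_round_in_unit: "N > 0 \<Longrightarrow> v \<in> {0..1} \<Longrightarrow> grid_round N v \<in> {0..1}"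
  using grid_round_mono[of 0 v N] grid_round_mono[of v 1 N]
  by (simp add: grid_round_0 grid_round_1)

text \<open>The numerator in \<open>grid_round\<close> is a sum of two integers. The fractions
  obtained are those that \<open>grid_denominator\<close> places in
  \<open>fine_grid\<close>.\<close>

lemma grid_round_unit_cases:
  assumes "N > 0" "v \<in> {0..1}"
  obtains k :: int where "k \<in> {0..2 * int N}" "grid_round N v = of_int k / (2 * of_nat N)"
proof
  let ?k = "\<lfloor>real N * v\<rfloor> + \<lceil>real N * v\<rceil>"
  show eq: "grid_round N v = of_int ?k / (2 * of_nat N)"
    by (simp add: grid_round_def)
  have "0 \<le> of_int ?k / (2 * real N)" "of_int ?k / (2 * real N) \<le> 1"
    using grid_round_in_unit[OF assms] unfolding eq by auto
  then have "0 \<le> real_of_int ?k" "real_of_int ?k \<le> real_of_int (2 * int N)"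
    using assms(1) by (simp_all add: field_simps)
  then show "?k \<in> {0..2 * int N}"
    by (simp only: of_int_le_iff of_int_0_le_iff atLeastAtMost_iff)
qed

lemma finite_grid_round_unit: "N > 0 \<Longrightarrow> finite (grid_round N ` {0..1})"
  by (rule finite_subset[of _ "(\<lambda>k. of_int k / (2 * of_nat N)) ` {0..2 * int N}"])
    (auto elim!: grid_round_unit_cases)

text \<open>Strictness survives because the threshold is a grid point: the floor drops below
  \<open>k\<close> while the ceiling does not exceed it. A midpoint as threshold would fail.\<close>

lemma grid_round_less_grid:
  assumes "N > 0" "v < of_int k / of_nat N"
  shows "grid_round N v < of_int k / of_nat N"
proof -
  have "of_nat N * v < of_int k" using assms by (simp add: field_simps)
  then have "\<lfloor>of_nat N * v\<rfloor> < k" "\<lceil>of_nat N * v\<rceil> \<le> k"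
    by (simp_all add: floor_less_iff ceiling_le_iff)
  then have "real_of_int (\<lfloor>of_nat N * v\<rfloor> + \<lceil>of_nat N * v\<rceil>) < of_int (2 * k)"
    by (subst of_int_less_iff) simp
  then have "grid_round N v < of_int (2 * k) / (2 * of_nat N)"
    unfolding grid_round_def of_int_add using assms(1) by (intro divide_strict_right_mono) auto
  then show ?thesis by simp
qed

text \<open>The weak comparisons follow from monotonicity, since the threshold is fixed by rounding;
  \<open>Gt\<close> is reduced to \<open>Lt\<close> by negation. This transfers the assertions of
  \<open>\<Gamma>\<close> to the rounded model.\<close>

lemma grid_round_cmp_grid:
  assumes N: "N > 0" and "cmp_holds b v (of_int k / of_nat N)"
  shows "cmp_holds b (grid_round N v) (of_int k / of_nat N)"
proof (cases b)
  case Lt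
  then show ?thesis using assms by (simp add: grid_round_less_grid)
next
  case Le
  then show ?thesis using assms(2) grid_round_mono[of v _ N] grid_round_grid[OF N, of k] by force
next
  case Gt
  then show ?thesis
    using assms grid_round_less_grid[of N "- v" "- k"] by (simp add: grid_round_minus)
next
  case Ge
  then show ?thesis using assms(2) grid_round_mono[of _ v N] grid_round_grid[OF N, of k] by force
qed


section \<open>The grid of constants\<close>

lemma group_closure_of_int_mult:
  fixes s :: "'a::comm_ring_1"
  assumes "s \<in> group_closure S"
  shows "of_int k * s \<in> group_closure S"
proof (cases "k \<ge> 0")
  case True
  then show ?thesis using group_closure_scalar_mult_left[OF assms, of "nat k"] by simp
next
  case False
  then have "of_int k * s = - (of_nat (nat (- k)) * s)" by simp
  then show ?thesis using group_closure_scalar_mult_left[OF assms, of "nat (- k)"] by simp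
qed

text \<open>Division with remainder: the remainder of \<open>g\<close> modulo
  \<open>\<delta>\<close> lies in the group and in [0,\<delta>), hence is zero.\<close>

lemma group_closure_least_positive:
  fixes S :: "rat set" and \<delta> :: rat
  assumes "\<delta> \<in> group_closure S" "\<delta> > 0"
    and least: "\<And>s. s \<in> group_closure S \<Longrightarrow> 0 < s \<Longrightarrow> \<delta> \<le> s"
    and g: "g \<in> group_closure S"
  obtains k :: int where "g = of_int k * \<delta>"
proof
  let ?k = "\<lfloor>g / \<delta>\<rfloor>"
  have "0 \<le> g - of_int ?k * \<delta>" "g - of_int ?k * \<delta> < \<delta>"
    using floor_divide_lower[OF \<open>\<delta> > 0\<close>, of g] floor_divide_upper[OF \<open>\<delta> > 0\<close>, of g]
    by (simp_all add: algebra_simps)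
  moreover have "g - of_int ?k * \<delta> \<in> group_closure S"
    using group_closure.diff[OF g group_closure_of_int_mult[OF assms(1)]] .
  ultimately show "g = of_int ?k * \<delta>" using least[of "g - of_int ?k * \<delta>"] by force
qed

text \<open>The least positive grid element \<open>\<delta>\<close> generates the group, and 1 is in
  the group, so \<open>\<delta>\<close> is 1/N for some N. Then \<open>half_step\<close> is
  1/(2N).\<close>

lemma grid_denominator:
  assumes "finite \<T>" "finite \<Gamma>"
  obtains N :: nat where "N > 0"
    and "\<And>g. g \<in> sequent_consts \<Gamma> \<union> tbox_consts \<T> \<Longrightarrow> \<exists>k. g = of_int k / of_nat N"
    and "\<And>k. k \<in> {0..2 * int N} \<Longrightarrow> of_int k / (2 * of_nat N) \<in> fine_grid \<T> \<Gamma>"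
proof -
  let ?G = "group_closure (insert 1 (sequent_consts \<Gamma> \<union> tbox_consts \<T>))"
  let ?V = "value_grid \<T> \<Gamma>"
  define \<delta> where "\<delta> = Min (?V - {0})"
  have fin: "finite (?V - {0})" using finite_value_grid[OF assms] by simp
  have 1: "1 \<in> ?V - {0}" by (auto simp: value_grid_def intro: group_closure.base)
  have "\<delta> \<in> ?V - {0}" unfolding \<delta>_def using fin 1 by (intro Min_in) auto
  then have \<delta>: "\<delta> \<in> ?G" "\<delta> > 0" "\<delta> \<le> 1" by (auto simp: value_grid_def)
  \<comment> \<open>Minimality inside [0,1] extends to the whole group, because
    \<open>\<delta>\<close> is at most 1.\<close>
  have "\<delta> \<le> s" if "s \<in> ?G" "0 < s" for s
  proof (cases "s \<le> 1")
    case True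
    with that have "s \<in> ?V - {0}" by (simp add: value_grid_def)
    then show ?thesis unfolding \<delta>_def using fin by (intro Min_le) auto
  next
    case False
    then show ?thesis using \<delta>(3) by simp
  qed
  then have mult: "\<exists>k. g = of_int k * \<delta>" if "g \<in> ?G" for g
    using group_closure_least_positive[OF \<delta>(1,2) _ that] by metis
  obtain n where n: "1 = of_int n * \<delta>" using mult[of 1] 1 by (auto simp: value_grid_def)
  have "n > 0"
  proof (rule ccontr)
    assume "\<not> n > 0"
    then have "of_int n * \<delta> \<le> 0" using \<delta>(2) by (simp add: mult_nonpos_nonneg)
    then show False using n by simp
  qed
  then obtain N where N: "n = int N" "N > 0" using pos_int_cases by blast
  have \<delta>N: "\<delta> = 1 / of_nat N" using n N by (simp add: field_simps)
  show thesis
  proof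
    show "N > 0" by (rule N)
  next
    fix g assume "g \<in> sequent_consts \<Gamma> \<union> tbox_consts \<T>"
    then have "g \<in> ?G" by (auto intro: group_closure.base)
    then show "\<exists>k. g = of_int k / of_nat N" using mult \<delta>N by auto
  next
    have V: "of_int m / of_nat N \<in> ?V" if "0 \<le> m" "m \<le> int N" for m
    proof -
      have "of_int m / of_nat N \<in> ?G"
        using group_closure_of_int_mult[OF \<delta>(1), of m] \<delta>N by simp
      moreover have "of_int m \<le> (of_int (int N) :: rat)"
        using that(2) by (simp only: of_int_le_iff)
      ultimately show ?thesis using that N(2) by (simp add: value_grid_def)
    qed
    fix k assume k: "k \<in> {0..2 * int N}"
    show "of_int k / (2 * of_nat N) \<in> fine_grid \<T> \<Gamma>"
    \<comment> \<open>Even \<open>k\<close> give points of \<open>value_grid\<close>, odd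
      \<open>k\<close> the shifts by \<open>half_step\<close>. For odd \<open>k\<close> the base
      point is below 1, as \<open>fine_grid\<close> demands.\<close>
    proof (cases "even k")
      case True
      then obtain m where "k = 2 * m" by blast
      then show ?thesis using V[of m] k by (auto simp: fine_grid_def)
    next
      case False
      then obtain m where m: "k = 2 * m + 1" by (auto elim: oddE)
      with k have "0 \<le> m" "m < int N" by auto
      then have "of_int m / of_nat N \<in> ?V" "(of_int m :: rat) \<noteq> of_int (int N)"
        using V[of m] by simp_all
      moreover have "of_int k / (2 * of_nat N) = of_int m / of_nat N + half_step \<T> \<Gamma>"
        using \<delta>N N(2) m by (simp add: half_step_def \<delta>_def[symmetric] field_simps)
      moreover from calculation(2) have "(of_int m / of_nat N :: rat) \<noteq> 1"
        using N(2) by simp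
      ultimately show ?thesis unfolding fine_grid_def by blast
    qed
  qed
qed


section \<open>Semantics of concepts\<close>

text \<open>Well-formedness bounds constants and makes subtracted constants nonnegative, so that
  \<open>Minus\<close> cannot exceed 1. For \<open>Exists\<close> the conditional supremum needs a
  nonempty carrier and a bounded image.\<close>

lemma sem_in_unit:
  assumes I: "interpretation_ok I" and "wf_concept C" "x \<in> carr I"
  shows "sem I C x \<in> {0..1}"
  using assms(2,3)
proof (induction C arbitrary: x)
  case (Exists R C)
  have ne: "carr I \<noteq> {}" using I by (simp add: interpretation_ok_def)
  have b: "min (role_val I R x y) (sem I C y) \<in> {0..1}" if "y \<in> carr I" for y
    using Exists.IH[OF _ that] Exists.prems I that
    by (auto simp: wf_concept_def interpretation_ok_def)
  obtain y where y: "y \<in> carr I" using ne by blast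
  have "bdd_above ((\<lambda>y. min (role_val I R x y) (sem I C y)) ` carr I)"
    using b by (intro bdd_aboveI2[of _ _ 1]) auto
  with y b[OF y] have "0 \<le> sem I (Exists R C) x"
    by (auto intro: cSUP_upper2)
  moreover have "sem I (Exists R C) x \<le> 1"
    using b ne by (auto intro!: cSUP_least)
  ultimately show ?case by simp
next
  case (Minus C c)
  then have "0 \<le> (of_rat c :: real)" "sem I C x \<in> {0..1}" by (auto simp: wf_concept_def)
  then show ?case unfolding sem.simps atLeastAtMost_iff by linarith
qed (use I in \<open>auto simp: wf_concept_def interpretation_ok_def min_le_iff_disj\<close>)

lemma sem_Plus: "sem I (Plus C c) x = min 1 (sem I C x + of_rat c)"
  by (simp add: Plus_def)

lemma sem_Disj: "sem I (Disj C D) x = max (sem I C x) (sem I D x)"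
  by (simp add: Disj_def)

lemma sem_Big_Conj_ge_1: "(\<And>C. C \<in> set Cs \<Longrightarrow> 1 \<le> sem I C x) \<Longrightarrow> 1 \<le> sem I (Big_Conj Cs) x"
  by (induction Cs rule: Big_Conj.induct) auto

lemma sem_Big_Disj_ge: "C \<in> set Cs \<Longrightarrow> sem I C x \<le> sem I (Big_Disj Cs) x"
  by (induction Cs rule: Big_Disj.induct) (auto simp: sem_Disj le_max_iff_disj)

text \<open>The disjunct for \<open>z\<close> has value 1 exactly when \<open>z\<close> separates
  the two values, since both truncated sums must reach 1.\<close>

lemma sem_gci_concept_ge_1:
  assumes "finite Z" "z \<in> Z" "sem I C x \<le> of_rat z" "of_rat z \<le> sem I D x"
  shows "1 \<le> sem I (gci_concept Z (C, D)) x"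
proof -
  have "1 \<le> sem I (Conj (Plus (Neg C) z) (Plus D (1 - z))) x"
    using assms(3,4) by (simp add: sem_Plus of_rat_diff)
  also have "\<dots> \<le> sem I (gci_concept Z (C, D)) x"
    unfolding gci_concept_def prod.case using assms(1,2) by (intro sem_Big_Disj_ge) auto
  finally show ?thesis .
qed

section \<open>Finitely valued interpretations, in which suprema are maxima\<close>

definition finite_valued :: "('a, 'r, 'd) interp \<Rightarrow> bool" where
  "finite_valued I \<longleftrightarrow> (\<forall>p. finite (atom_val I p ` carr I))
     \<and> (\<forall>R. finite ((\<lambda>(x, y). role_val I R x y) ` (carr I \<times> carr I)))"

lemma finite_image_min:
  assumes "finite (f ` A)" "finite (g ` A)"
  shows "finite ((\<lambda>x. min (f x) (g x)) ` A)"
  by (rule finite_subset[OF _ finite_UnI[OF assms]]) (auto simp: min_def)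

lemma finite_role_min:
  assumes "finite ((\<lambda>(x, y). r x y) ` (A \<times> A))" "finite (g ` A)"
  shows "finite ((\<lambda>(x, y). min (r x y) (g y)) ` (A \<times> A))"
  by (rule finite_subset[OF _ finite_UnI[OF assms]]) (force simp: min_def)

lemma finite_sem_image:
  assumes I: "finite_valued I" "carr I \<noteq> {}"
  shows "finite (sem I C ` carr I)"
proof (induction C)
  case (Neg C)
  then show ?case by (simp add: finite_imageI flip: image_image[of "\<lambda>v. 1 - v" "sem I C"])
next
  case (Minus C c)
  then show ?case
    by (simp add: finite_imageI flip: image_image[of "\<lambda>v. max (v - of_rat c) 0" "sem I C"])
next
  case (Conj C D)
  then show ?case by (simp add: finite_image_min)
next
  case (Exists R C)
  \<comment> \<open>Collecting the values over all pairs gives one finite set that works for every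
    \<open>x\<close>; each supremum, being a maximum, is a member of it.\<close>
  let ?V = "(\<lambda>(x, y). min (role_val I R x y) (sem I C y)) ` (carr I \<times> carr I)"
  have fin: "finite ?V"
    using I(1) Exists.IH by (intro finite_role_min) (auto simp: finite_valued_def)
  have "sem I (Exists R C) x \<in> ?V" if "x \<in> carr I" for x
  proof -
    let ?W = "(\<lambda>y. min (role_val I R x y) (sem I C y)) ` carr I"
    have sub: "?W \<subseteq> ?V" using that by auto
    then have "finite ?W" using fin finite_subset by blast
    then have "Sup ?W \<in> ?W" using I(2) by (simp add: cSup_eq_Max)
    then show ?thesis using sub by auto
  qed
  then show ?case using fin by (meson finite_subset image_subsetI)
next
  case (Const c)
  then show ?case by (auto intro: finite_subset[of _ "{of_rat c}"])
qed (use I in \<open>auto simp: finite_valued_def\<close>)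

lemma finite_exists_values:
  assumes "finite_valued I" "carr I \<noteq> {}" "x \<in> carr I"
  shows "finite ((\<lambda>y. min (role_val I R x y) (sem I C y)) ` carr I)"
proof (rule finite_subset)
  show "finite ((\<lambda>(x, y). min (role_val I R x y) (sem I C y)) ` (carr I \<times> carr I))"
    using assms finite_sem_image[OF assms(1,2)]
    by (intro finite_role_min) (auto simp: finite_valued_def)
qed (use assms(3) in auto)

lemma sem_Exists_upper:
  assumes "finite_valued I" "x \<in> carr I" "y \<in> carr I"
  shows "min (role_val I R x y) (sem I C y) \<le> sem I (Exists R C) x"
  using assms finite_exists_values[OF assms(1) _ assms(2)]
  by (auto intro!: cSUP_upper bdd_above_finite)

lemma sem_Exists_attained:
  assumes "finite_valued I" "x \<in> carr I"
  obtains y where "y \<in> carr I" "sem I (Exists R C) x = min (role_val I R x y) (sem I C y)"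
proof -
  let ?W = "(\<lambda>y. min (role_val I R x y) (sem I C y)) ` carr I"
  have ne: "carr I \<noteq> {}" using assms by auto
  then have "finite ?W" using finite_exists_values assms by metis
  then have "Sup ?W \<in> ?W" using ne by (simp add: cSup_eq_Max)
  then show thesis using that by auto
qed


section \<open>The rounded ultrapower\<close>

text \<open>
  Equality of individuals does not occur in the language, so the sequences need not be identified
  modulo the ultrafilter.
\<close>

definition rounded_ultrapower ::
    "nat filter \<Rightarrow> nat \<Rightarrow> ('a, 'r, 'd) interp \<Rightarrow> ('a, 'r, nat \<Rightarrow> 'd) interp" where
  "rounded_ultrapower F N I =
     \<lparr> carr = {x. \<forall>n. x n \<in> carr I},
       atom_val = \<lambda>p x. grid_round N (Lim F (\<lambda>n. atom_val I p (x n))),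
       role_val = \<lambda>R x y. grid_round N (Lim F (\<lambda>n. role_val I R (x n) (y n))) \<rparr>"

lemma rounded_ultrapower_ok:
  assumes I: "interpretation_ok I" and F: "ultrafilter F" and N: "N > 0"
  shows "interpretation_ok (rounded_ultrapower F N I)"
proof -
  obtain a where "a \<in> carr I" using I by (auto simp: interpretation_ok_def)
  then have "(\<lambda>_. a) \<in> carr (rounded_ultrapower F N I)"
    by (simp add: rounded_ultrapower_def)
  then show ?thesis
    using I unfolding interpretation_ok_def
    by (auto simp: rounded_ultrapower_def simp del: atLeastAtMost_iff
        intro!: grid_round_in_unit[OF N] ultrafilter_Lim_in_unit[OF F])
qed

lemma rounded_ultrapower_finite_valued:
  assumes I: "interpretation_ok I" and F: "ultrafilter F" and N: "N > 0"
  shows "finite_valued (rounded_ultrapower F N I)"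
  unfolding finite_valued_def
proof (intro conjI allI)
  fix p
  show "finite (atom_val (rounded_ultrapower F N I) p ` carr (rounded_ultrapower F N I))"
    using I by (intro finite_subset[OF _ finite_grid_round_unit[OF N]])
      (auto simp: rounded_ultrapower_def interpretation_ok_def simp del: atLeastAtMost_iff
        intro!: imageI ultrafilter_Lim_in_unit[OF F])
next
  fix R
  show "finite ((\<lambda>(x, y). role_val (rounded_ultrapower F N I) R x y) `
          (carr (rounded_ultrapower F N I) \<times> carr (rounded_ultrapower F N I)))"
    using I by (intro finite_subset[OF _ finite_grid_round_unit[OF N]])
      (auto simp: rounded_ultrapower_def interpretation_ok_def simp del: atLeastAtMost_iff
        intro!: imageI ultrafilter_Lim_in_unit[OF F])
qed

text \<open>An analogue of the theorem of Los. Propositional connectives are continuous, so they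
  commute with \<open>Lim\<close>, and they commute with rounding because the constants lie on the
  grid. For \<open>Exists\<close>, a sequence of approximate witnesses is a single individual that
  attains the supremum.\<close>

lemma sem_rounded_ultrapower:
  fixes I :: "('a, 'r, 'd) interp"
  assumes I: "interpretation_ok I"
    and F: "ultrafilter F" "F \<le> sequentially" and N: "N > 0"
    and "wf_concept C" "\<forall>c\<in>concept_consts C. \<exists>k. c = of_int k / of_nat N"
    and "\<And>n. x n \<in> carr I"
  shows "sem (rounded_ultrapower F N I) C x = grid_round N (Lim F (\<lambda>n. sem I C (x n)))"
  using assms(5-7)
proof (induction C arbitrary: x)
  case (Atom p)
  then show ?case by (simp add: rounded_ultrapower_def)
next
  case (Const c)
  then obtain k where "c = of_int k / of_nat N" by auto
  then show ?case
    using N ultrafilter_nontrivial[OF F(1)]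
    by (simp add: tendsto_Lim[OF _ tendsto_const] of_rat_divide grid_round_grid)
next
  case (Neg C)
  then have "((\<lambda>n. sem I C (x n)) \<longlongrightarrow> Lim F (\<lambda>n. sem I C (x n))) F"
    by (intro ultrafilter_tendsto_Lim[OF F(1)] sem_in_unit[OF I]) (auto simp: wf_concept_def)
  then have "Lim F (\<lambda>n. sem I (Neg C) (x n)) = 1 - Lim F (\<lambda>n. sem I C (x n))"
    by (simp, intro tendsto_Lim ultrafilter_nontrivial[OF F(1)] tendsto_intros)
  then show ?case using Neg N by (simp add: wf_concept_def grid_round_compl)
next
  case (Minus C c)
  then obtain k where k: "c = of_int k / of_nat N" by auto
  from Minus have "((\<lambda>n. sem I C (x n)) \<longlongrightarrow> Lim F (\<lambda>n. sem I C (x n))) F"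
    by (intro ultrafilter_tendsto_Lim[OF F(1)] sem_in_unit[OF I]) (auto simp: wf_concept_def)
  then have "Lim F (\<lambda>n. sem I (Minus C c) (x n)) = max (Lim F (\<lambda>n. sem I C (x n)) - of_rat c) 0"
    by (simp, intro tendsto_Lim ultrafilter_nontrivial[OF F(1)] tendsto_intros tendsto_max)
  then show ?case
    using Minus N k
    by (simp add: wf_concept_def grid_round_max grid_round_0 of_rat_divide grid_round_diff_grid)
next
  case (Conj C D)
  then have "((\<lambda>n. sem I C (x n)) \<longlongrightarrow> Lim F (\<lambda>n. sem I C (x n))) F"
      "((\<lambda>n. sem I D (x n)) \<longlongrightarrow> Lim F (\<lambda>n. sem I D (x n))) F"
    by (auto intro!: ultrafilter_tendsto_Lim[OF F(1)] sem_in_unit[OF I]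
        simp: wf_concept_def simp del: atLeastAtMost_iff)
  then have "Lim F (\<lambda>n. sem I (Conj C D) (x n)) =
      min (Lim F (\<lambda>n. sem I C (x n))) (Lim F (\<lambda>n. sem I D (x n)))"
    by (simp, intro tendsto_Lim ultrafilter_nontrivial[OF F(1)] tendsto_intros tendsto_min)
  then show ?case using Conj by (simp add: wf_concept_def grid_round_min)
next
  case (Exists R C)
  let ?J = "rounded_ultrapower F N I"
  let ?f = "\<lambda>x y. min (role_val I R x y) (sem I C y)"
  let ?s = "\<lambda>n. sem I (Exists R C) (x n)"
  note nb = ultrafilter_nontrivial[OF F(1)]
  have wf: "wf_concept C" using Exists.prems by (simp add: wf_concept_def)
  have s: "(?s \<longlongrightarrow> Lim F ?s) F"
    using Exists.prems by (intro ultrafilter_tendsto_Lim[OF F(1)] sem_in_unit[OF I]) auto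
  have bdd: "bdd_above (?f (x n) ` carr I)" for n
    using sem_in_unit[OF I wf] by (intro bdd_aboveI2[of _ _ 1] min.coboundedI2) simp
  have eq: "min (role_val ?J R x y) (sem ?J C y) = grid_round N (Lim F (\<lambda>n. ?f (x n) (y n)))"
    and lim: "((\<lambda>n. ?f (x n) (y n)) \<longlongrightarrow> Lim F (\<lambda>n. ?f (x n) (y n))) F"
    if y: "\<And>n. y n \<in> carr I" for y
  proof -
    have "((\<lambda>n. sem I C (y n)) \<longlongrightarrow> Lim F (\<lambda>n. sem I C (y n))) F"
      using y by (intro ultrafilter_tendsto_Lim[OF F(1)] sem_in_unit[OF I wf])
    moreover have "((\<lambda>n. role_val I R (x n) (y n)) \<longlongrightarrow> Lim F (\<lambda>n. role_val I R (x n) (y n))) F"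
      using y Exists.prems(3) I
      by (intro ultrafilter_tendsto_Lim[OF F(1)]) (auto simp: interpretation_ok_def)
    ultimately have l: "((\<lambda>n. ?f (x n) (y n)) \<longlongrightarrow>
        min (Lim F (\<lambda>n. role_val I R (x n) (y n))) (Lim F (\<lambda>n. sem I C (y n)))) F"
      by (intro tendsto_min)
    then show "((\<lambda>n. ?f (x n) (y n)) \<longlongrightarrow> Lim F (\<lambda>n. ?f (x n) (y n))) F"
      using tendsto_Lim[OF nb l] by simp
    have "sem ?J C y = grid_round N (Lim F (\<lambda>n. sem I C (y n)))"
      using Exists.IH[OF wf _ y] Exists.prems(2) by simp
    then show "min (role_val ?J R x y) (sem ?J C y) = grid_round N (Lim F (\<lambda>n. ?f (x n) (y n)))"
      unfolding tendsto_Lim[OF nb l] by (simp add: rounded_ultrapower_def grid_round_min)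
  qed
  have ne: "carr I \<noteq> {}" using I by (simp add: interpretation_ok_def)
  \<comment> \<open>The supremum in \<open>I\<close> need not be attained, so a positive error is
    allowed; \<open>Suc\<close> keeps it positive at \<open>n = 0\<close>.\<close>
  have "\<exists>y\<in>carr I. ?s n - 1 / Suc n < ?f (x n) y" for n
    by (subst less_cSUP_iff[OF ne bdd, symmetric]) simp
  then obtain y where y: "\<And>n. y n \<in> carr I" "\<And>n. ?s n - 1 / Suc n < ?f (x n) (y n)"
    by metis
  have upper: "?f (x n) z \<le> ?s n" if "z \<in> carr I" for n z
    using cSUP_upper[OF that bdd[of n]] by simp
  \<comment> \<open>Here \<open>F \<le> sequentially\<close> enters: the errors vanish along
    \<open>F\<close>.\<close>
  have "((\<lambda>n. 1 / real (Suc n)) \<longlongrightarrow> 0) F"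
    using F(2) LIMSEQ_Suc[OF lim_inverse_n'] by (rule tendsto_mono)
  then have "((\<lambda>n. ?s n - 1 / Suc n) \<longlongrightarrow> Lim F ?s) F"
    using tendsto_diff[OF s] by fastforce
  then have "((\<lambda>n. ?f (x n) (y n)) \<longlongrightarrow> Lim F ?s) F"
    by (rule tendsto_sandwich[OF _ _ _ s, rotated 2])
      (intro always_eventually allI less_imp_le[OF y(2)] upper[OF y(1)])+
  then have attained: "Lim F (\<lambda>n. ?f (x n) (y n)) = Lim F ?s"
    by (rule tendsto_Lim[OF nb])
  have "(SUP z\<in>carr ?J. min (role_val ?J R x z) (sem ?J C z)) = grid_round N (Lim F ?s)"
  proof (rule cSup_eq_maximum)
    show "grid_round N (Lim F ?s) \<in> (\<lambda>z. min (role_val ?J R x z) (sem ?J C z)) ` carr ?J"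
      unfolding attained[symmetric] eq[OF y(1), symmetric]
      using y(1) by (intro imageI) (simp add: rounded_ultrapower_def)
  next
    fix v assume "v \<in> (\<lambda>z. min (role_val ?J R x z) (sem ?J C z)) ` carr ?J"
    then obtain z where z: "\<And>n. z n \<in> carr I" and v: "v = min (role_val ?J R x z) (sem ?J C z)"
      by (auto simp: rounded_ultrapower_def)
    \<comment> \<open>No other sequence does better in the limit, so the value at \<open>y\<close>
      is the maximum.\<close>
    have "Lim F (\<lambda>n. ?f (x n) (z n)) \<le> Lim F ?s"
      by (intro tendsto_le[OF nb s lim[OF z]] always_eventually allI upper z)
    then show "v \<le> grid_round N (Lim F ?s)"
      unfolding v eq[OF z] by (rule grid_round_mono)
  qed
  then show ?case by simp
qed

text \<open>The given model is replaced by its rounded ultrapower, whose individuals are sequences;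
  the original individual survives as a constant sequence.\<close>

lemma finite_valued_model:
  fixes ts :: "('a, 'r) gci list" and \<Gamma> :: "('a, 'r) sequent"
  assumes wf: "wf_tbox (set ts)" "wf_sequent \<Gamma>"
    and sat: "tbox_satisfiable TYPE('d) (set ts) \<Gamma>"
  obtains J :: "('a, 'r, nat \<Rightarrow> 'd) interp" and x where "interpretation_ok J" "finite_valued J"
    "\<And>y. y \<in> carr J \<Longrightarrow> 1 \<le> sem J (assoc_concept ts \<Gamma>) y"
    "x \<in> carr J" "\<And>A. A \<in> \<Gamma> \<Longrightarrow> sat_assertion J x A"
proof -
  obtain I :: "('a, 'r, 'd) interp" and a where I: "interpretation_ok I"
    and T: "sat_tbox I (set ts)" and a: "a \<in> carr I" "\<And>A. A \<in> \<Gamma> \<Longrightarrow> sat_assertion I a A"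
    using sat by (auto simp: tbox_satisfiable_def)
  have fin: "finite \<Gamma>" using wf by (simp add: wf_sequent_def)
  obtain N where N: "N > 0"
    and grid: "\<And>g. g \<in> sequent_consts \<Gamma> \<union> tbox_consts (set ts) \<Longrightarrow> \<exists>k. g = of_int k / of_nat N"
    and fine: "\<And>k. k \<in> {0..2 * int N} \<Longrightarrow> of_int k / (2 * of_nat N) \<in> fine_grid (set ts) \<Gamma>"
    by (rule grid_denominator[OF finite_set fin]) blast
  obtain F :: "nat filter" where F: "ultrafilter F" "F \<le> sequentially"
    using exists_ultrafilter_le[of sequentially] by auto
  let ?J = "rounded_ultrapower F N I"
  note sem = sem_rounded_ultrapower[OF I F N]
  show thesis
  proof
    show "interpretation_ok ?J" by (rule rounded_ultrapower_ok[OF I F(1) N])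
    show "finite_valued ?J" by (rule rounded_ultrapower_finite_valued[OF I F(1) N])
    show "(\<lambda>_. a) \<in> carr ?J" using a by (simp add: rounded_ultrapower_def)
  next
    fix A assume A: "A \<in> \<Gamma>"
    obtain C b c where Cbc: "A = Assert C b c" by (cases A)
    have C: "wf_concept C" using wf(2) A Cbc by (auto simp: wf_sequent_def)
    \<comment> \<open>The bound \<open>c\<close> is included because rounding preserves comparisons
      with grid points.\<close>
    have sub: "insert c (concept_consts C) \<subseteq> sequent_consts \<Gamma>"
      using A unfolding sequent_consts_def Cbc by force
    then have cs: "\<forall>d\<in>concept_consts C. \<exists>k. d = of_int k / of_nat N" using grid by blast
    obtain k where k: "c = of_int k / of_nat N" using sub grid by blast
    have "sem ?J C (\<lambda>_. a) = grid_round N (sem I C a)"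
      using sem[OF C cs, of "\<lambda>_. a"] a ultrafilter_nontrivial[OF F(1)]
      by (simp add: tendsto_Lim[OF _ tendsto_const])
    then show "sat_assertion ?J (\<lambda>_. a) A"
      using a(2)[OF A] grid_round_cmp_grid[OF N, of b "sem I C a" k]
      by (simp add: Cbc k of_rat_divide)
  next
    fix y assume "y \<in> carr ?J"
    then have y: "y n \<in> carr I" for n by (simp add: rounded_ultrapower_def)
    have "1 \<le> sem ?J (gci_concept (fine_grid (set ts) \<Gamma>) (C, D)) y" if CD: "(C, D) \<in> set ts" for C D
    proof -
      have C: "wf_concept C" and D: "wf_concept D" using wf(1) CD by (auto simp: wf_tbox_def)
      have sub: "concept_consts C \<union> concept_consts D \<subseteq> tbox_consts (set ts)"
        using CD unfolding tbox_consts_def by force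
      let ?c = "Lim F (\<lambda>n. sem I C (y n))" and ?d = "Lim F (\<lambda>n. sem I D (y n))"
      have eqs: "sem ?J C y = grid_round N ?c" "sem ?J D y = grid_round N ?d"
        using sub grid by (blast intro: sem C D y)+
      have "?c \<le> ?d"
      proof (rule tendsto_le[OF ultrafilter_nontrivial[OF F(1)]])
        show "\<forall>\<^sub>F n in F. sem I C (y n) \<le> sem I D (y n)"
          using T CD y by (auto simp: sat_tbox_def)
      qed (intro ultrafilter_tendsto_Lim[OF F(1)] sem_in_unit[OF I] C D y)+
      then have le: "sem ?J C y \<le> sem ?J D y" unfolding eqs by (rule grid_round_mono)
      have "?c \<in> {0..1}" by (intro ultrafilter_Lim_in_unit[OF F(1)] sem_in_unit[OF I] C y)
      \<comment> \<open>The separating point is the rounded value of \<open>C\<close> itself, which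
        lies in \<open>fine_grid\<close> and below the value of \<open>D\<close>.\<close>
      then obtain k where k: "k \<in> {0..2 * int N}" "grid_round N ?c = of_int k / (2 * of_nat N)"
        using grid_round_unit_cases[OF N] by metis
      have "sem ?J C y = of_rat (of_int k / (2 * of_nat N))"
        unfolding eqs k(2) by (simp add: of_rat_divide of_rat_mult)
      with le show ?thesis
        by (intro sem_gci_concept_ge_1[OF finite_fine_grid[OF finite_set fin] fine[OF k(1)]]) auto
    qed
    then show "1 \<le> sem ?J (assoc_concept ts \<Gamma>) y"
      unfolding assoc_concept_def by (auto intro!: sem_Big_Conj_ge_1)
  qed
qed


section \<open>Soundness of the rules\<close>

text \<open>Strictness comes from one of the two comparisons, or from \<open>clash\<close> when both
  are weak. Taking \<open>u = w\<close> refutes the premise of \<open>Ax_p\<close>; the case of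
  distinct values serves the existential rule.\<close>

lemma clash_unsat:
  fixes u w :: real
  assumes "l \<in> {Lt, Le}" "g \<in> {Gt, Ge}" "clash l g c d"
    and "cmp_holds l u (of_rat c)" "cmp_holds g w (of_rat d)"
  shows "u < w"
proof -
  have "(of_rat c :: real) \<le> of_rat d"
    using assms(3) by (auto simp: clash_def of_rat_less_eq split: if_splits)
  moreover have "(of_rat c :: real) < of_rat d" if "l = Le" "g = Ge"
    using assms(3) that by (auto simp: clash_def of_rat_less)
  ultimately show ?thesis using assms by fastforce
qed

text \<open>The individual stays the same. Axioms have only \<open>Bot\<close> as conclusion, so
  their cases refute the premise.\<close>

lemma prop_rule_sound:
  assumes "prop_rule S Ls" and I: "interpretation_ok I" and x: "x \<in> carr I"
    and sat: "\<forall>A\<in>S. sat_assertion I x A"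
  shows "\<exists>S'. Seq S' \<in> Ls \<and> (\<forall>A\<in>S'. sat_assertion I x A)"
  using assms(1)
proof cases
  case (Ax_1 g c p S0)
  have le: "atom_val I p x \<le> 1" using I x by (simp add: interpretation_ok_def)
  have "\<not> cmp_holds g (atom_val I p x) (of_rat c)"
    using Ax_1(3)
  proof (elim disjE conjE)
    assume g: "g = Gt" and "1 \<le> c"
    then have "1 \<le> (of_rat c :: real)" by simp
    with le show ?thesis unfolding g cmp_holds.simps by linarith
  next
    assume g: "g = Ge" and "1 < c"
    then have "1 < (of_rat c :: real)" by simp
    with le show ?thesis unfolding g cmp_holds.simps by linarith
  qed
  then show ?thesis using Ax_1(1) sat by simp
next
  case (Ax_0 l c p S0)
  have ge: "0 \<le> atom_val I p x" using I x by (simp add: interpretation_ok_def)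
  have "\<not> cmp_holds l (atom_val I p x) (of_rat c)"
    using Ax_0(3)
  proof (elim disjE conjE)
    assume l: "l = Lt" and "c \<le> 0"
    then have "(of_rat c :: real) \<le> 0" by simp
    with ge show ?thesis unfolding l cmp_holds.simps by linarith
  next
    assume l: "l = Le" and "c < 0"
    then have "(of_rat c :: real) < 0" by simp
    with ge show ?thesis unfolding l cmp_holds.simps by linarith
  qed
  then show ?thesis using Ax_0(1) sat by simp
next
  case (Ax_c l c d S0)
  then have "cmp_holds l (of_rat c :: real) (of_rat d)" using sat by simp
  then have "cmp_holds l c d" using Ax_c(3) by (auto simp: of_rat_less of_rat_less_eq)
  then show ?thesis using Ax_c(4) by simp
next
  case (Ax_p l g c d p S0)
  have "sat_assertion I x (Assert (Atom p) l c)" "sat_assertion I x (Assert (Atom p) g d)"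
    using Ax_p(1) sat by blast+
  then have "atom_val I p x < atom_val I p x"
    by (intro clash_unsat[OF Ax_p(3-5)]) simp_all
  then show ?thesis by simp
next
  case (Conj_gt g C D c S0)
  then have "cmp_holds g (min (sem I C x) (sem I D x)) (of_rat c)" using sat by simp
  then have "cmp_holds g (sem I C x) (of_rat c)" "cmp_holds g (sem I D x) (of_rat c)"
    using Conj_gt(3) by auto
  then show ?thesis using Conj_gt(1,2) sat by simp
next
  case (Conj_lt l C D c S0)
  then have "cmp_holds l (min (sem I C x) (sem I D x)) (of_rat c)" using sat by simp
  then have "cmp_holds l (sem I C x) (of_rat c) \<or> cmp_holds l (sem I D x) (of_rat c)"
    using Conj_lt(3) by (auto simp: min_less_iff_disj min_le_iff_disj)
  then show ?thesis
  proof
    assume "cmp_holds l (sem I C x) (of_rat c)"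
    then show ?thesis
      using Conj_lt(1,2) sat by (intro exI[of _ "insert (Assert C l c) S0"]) simp
  next
    assume "cmp_holds l (sem I D x) (of_rat c)"
    then show ?thesis
      using Conj_lt(1,2) sat by (intro exI[of _ "insert (Assert D l c) S0"]) simp
  qed
next
  case (Neg C b c S0)
  then have "cmp_holds b (1 - sem I C x) (of_rat c)" using sat by simp
  then have "cmp_holds (cmp_rev b) (sem I C x) (of_rat (1 - c))"
    by (cases b) (auto simp: of_rat_diff)
  then show ?thesis using Neg sat by simp
next
  case (Minus_lt l C c d S0)
  then have "cmp_holds l (max (sem I C x - of_rat c) 0) (of_rat d)" using sat by simp
  \<comment> \<open>An upper bound on a maximum bounds both arguments; the argument 0 yields the
    constraint on \<open>d\<close>.\<close>
  then have "cmp_holds l (sem I C x) (of_rat (d + c))" "cmp_holds (cmp_rev l) (of_rat d :: real) 0"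
    using Minus_lt(3) by (auto simp: of_rat_add)
  then show ?thesis using Minus_lt(1,2) sat by simp
next
  case (Minus_gt g d C c S0)
  then have "cmp_holds g (max (sem I C x - of_rat c) 0) (of_rat d)" using sat by simp
  \<comment> \<open>By the side condition 0 fails the lower bound, so the other argument of the
    maximum satisfies it.\<close>
  then have "cmp_holds g (sem I C x) (of_rat (d + c))"
    using Minus_gt(3) by (auto simp: of_rat_add less_max_iff_disj le_max_iff_disj)
  then show ?thesis using Minus_gt(1,2) sat by simp
qed

text \<open>The successor is an individual attaining the supremum for \<open>C\<close>; for the
  bound \<open>Ge\<close> an approximate witness would not suffice.\<close>

lemma ex_rule_sound:
  assumes "ex_rule T S S'" and I: "finite_valued I"
    and T: "\<And>y. y \<in> carr I \<Longrightarrow> 1 \<le> sem I T y"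
    and x: "x \<in> carr I" and sat: "\<forall>A\<in>S. sat_assertion I x A"
  shows "\<exists>y\<in>carr I. \<forall>A\<in>S'. sat_assertion I y A"
  using assms(1)
proof cases
  case (Ex_gt g c n l R S0 D d C)
  obtain y where y: "y \<in> carr I" "sem I (Exists R C) x = min (role_val I R x y) (sem I C y)"
    using sem_Exists_attained[OF I x] by metis
  have "sat_assertion I x (Assert (Exists R C) g c)" using sat Ex_gt(1) by blast
  then have "cmp_holds g (min (role_val I R x y) (sem I C y)) (of_rat c)"
    using y(2) by simp
  then have r: "cmp_holds g (role_val I R x y) (of_rat c)" and c: "cmp_holds g (sem I C y) (of_rat c)"
    using Ex_gt(3) by auto
  have "cmp_holds (l j) (sem I (D j) y) (of_rat (d j))"
    if j: "j < n" "clash (l j) g (d j) c" for j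
  proof -
    have l: "l j \<in> {Lt, Le}" using Ex_gt(4) j by blast
    have "sat_assertion I x (Assert (Exists R (D j)) (l j) (d j))"
      using sat Ex_gt(1) j by blast
    moreover have "min (role_val I R x y) (sem I (D j) y) \<le> sem I (Exists R (D j)) x"
      by (rule sem_Exists_upper[OF I x y(1)])
    ultimately have m: "cmp_holds (l j) (min (role_val I R x y) (sem I (D j) y)) (of_rat (d j))"
      using l by auto
    \<comment> \<open>The role value meets a lower bound that clashes with the upper bound on the
      minimum, so the minimum must be the value of \<open>D j\<close>.\<close>
    have "min (role_val I R x y) (sem I (D j) y) < role_val I R x y"
      using Ex_gt(3) by (intro clash_unsat[OF l _ j(2) m r]) auto
    with m show ?thesis by (simp add: min_def split: if_splits)
  qed
  with y(1) c T[OF y(1)] Ex_gt(2) show ?thesis by auto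
qed

section \<open>From satisfied labels to a consistent marking\<close>

lemma consistent_marking_if_model:
  assumes G: "tableau \<Gamma> T G" and I: "interpretation_ok I" "finite_valued I"
    and T: "\<And>y. y \<in> carr I \<Longrightarrow> 1 \<le> sem I T y"
    and x: "x \<in> carr I" "\<And>A. A \<in> \<Gamma> \<Longrightarrow> sat_assertion I x A"
  shows "\<exists>M. marking G M \<and> consistent M"
proof -
  define sat where "sat S \<longleftrightarrow> (\<exists>y\<in>carr I. \<forall>A\<in>S. sat_assertion I y A)" for S
  \<comment> \<open>Whether a vertex of \<open>G\<close> belongs to \<open>W\<close> depends on its
    label alone, so cycles in the graph do no harm and closure is checked one rule at a
    time.\<close>
  define W where "W = {v \<in> verts G. \<exists>S. label G v = Seq S \<and> sat S}"
  define M where "M = \<lparr> verts = W, edges = edges G \<inter> (W \<times> W), root = root G, label = label G \<rparr>"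
  have graph: "edges G \<subseteq> verts G \<times> verts G" "root G \<in> verts G"
    using G by (auto simp: tableau_def tableau_graph_def)
  then have child: "w \<in> verts G" if "w \<in> children G v" for v w
    using that by (auto simp: children_def)
  have "sat (\<Gamma> \<union> {Assert T Ge 1})"
    unfolding sat_def using x T[OF x(1)] by (intro bexI[of _ x]) auto
  then have root: "root G \<in> W"
    using G graph by (auto simp: W_def tableau_def)
  have "children G v \<subseteq> W" if v: "v \<in> W" "and_node G v" for v
  proof
    fix w assume w: "w \<in> children G v"
    obtain S where S: "label G v = Seq S" "sat S" using v(1) by (auto simp: W_def)
    have "label G ` children G v = {Seq S' | S S'. label G v = Seq S \<and> ex_rule T S S'}"
      using G v by (simp add: tableau_def)
    then obtain S' where S': "label G w = Seq S'" "ex_rule T S S'" using w S(1) by auto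
    have "sat S'" using S(2) ex_rule_sound[OF S'(2) I(2) T] unfolding sat_def by blast
    then show "w \<in> W" using child[OF w] S' by (simp add: W_def)
  qed
  moreover have "children G v \<inter> W \<noteq> {}" if v: "v \<in> W" "or_node G v" for v
  proof -
    obtain S where S: "label G v = Seq S" "sat S" using v(1) by (auto simp: W_def)
    then obtain Ls where Ls: "prop_rule S Ls" "label G ` children G v = Ls"
      using G v by (auto simp: tableau_def)
    obtain S' where S': "Seq S' \<in> Ls" "sat S'"
      using S(2) prop_rule_sound[OF Ls(1) I(1)] unfolding sat_def by metis
    then obtain w where "w \<in> children G v" "label G w = Seq S'" using Ls(2) by auto
    then show ?thesis using S'(2) child by (auto simp: W_def)
  qed
  ultimately have "marking G M"
    using root by (auto simp: marking_def full_subgraph_def M_def W_def)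
  moreover have "consistent M" by (auto simp: consistent_def M_def W_def)
  ultimately show ?thesis by blast
qed

theorem theorem2:
  fixes ts :: "('a, 'r) gci list"
    and \<Gamma> :: "('a, 'r) sequent"
    and G :: "('v, 'a, 'r) tgraph"
  assumes "wf_tbox (set ts)"
    and "wf_sequent \<Gamma>"
    and "tbox_satisfiable TYPE('d) (set ts) \<Gamma>"
    and "tableau \<Gamma> (assoc_concept ts \<Gamma>) G"
  shows "\<exists>M. marking G M \<and> consistent M"
proof -
  obtain J :: "('a, 'r, nat \<Rightarrow> 'd) interp" and x where "interpretation_ok J" "finite_valued J"
    "\<And>y. y \<in> carr J \<Longrightarrow> 1 \<le> sem J (assoc_concept ts \<Gamma>) y"
    "x \<in> carr J" "\<And>A. A \<in> \<Gamma> \<Longrightarrow> sat_assertion J x A"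
    using finite_valued_model[OF assms(1-3)] by blast
  then show ?thesis by (rule consistent_marking_if_model[OF assms(4)])
qed

end
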